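(* Let $D=\{f(a,a): a\ge 0\}$ and $S=\{p\ge 1: f(p,r)=p \text{ for some integer } r \text{ with } 0\le r<p\}$. Let $n$ be a positive integer and consider the (unique) winning opening move from the three-row Chomp rectangle $[n,n,n]$. Then: (1) No winning opening move from $[n,n,n]$ is made in the first row. (2) The winning opening move is made in the second row if and only if $n\in D$; in that case it is the move to $[n,a,a]$, where $a<n$ is the uniquely determined integer with $n=f(a,a)$. (3) The winning opening move is made in the third row if and only if $n\in S$; in that case it is the move to $[n,n,r]$, where $r<n$ is the uniquely determined integer with $f(n,r)=n$. Equivalently, the second-row values of $n$ form the OEIS sequence A029900 and the third-row values of $n$ form the OEIS sequence A029901. The first terms, in increasing order, of the two sequences of board sizes $n$ are: second row: $1,3,4,6,8,10,11,13,15,16,18,20,21,24,25,27,\ldots$; third row: $2,5,7,9,12,14,17,19,22,23,26,29,31,33,36,38,\ldots$.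
   Context: Three-row Chomp. A position is a triple $[p,q,r]$ of integers with $p\ge q\ge r\ge 0$, giving the lengths of the first, second and third rows of a left-justified board. Two players alternate moves. The moves from $[p,q,r]$ are: reduce the first row to length $a$ with $0\le a<p$ (a move made in the first row), giving $[a,\min(a,q),\min(a,r)]$; reduce the second row to length $a$ with $0\le a<q$ (a move made in the second row), giving $[p,a,\min(a,r)]$; reduce the third row to length $b$ with $0\le b<r$ (a move made in the third row), giving $[p,q,b]$. The player who moves to $[0,0,0]$ loses. A $P$-position is a position from which the previous player wins, and an $N$-position is one from which the next player wins. Equivalently: $[0,0,0]$ is an $N$-position, and a position other than $[0,0,0]$ is a $P$-position if and only if no move from it leads to a $P$-position. A move is winning if it leads to a $P$-position. The function $f$. For all integers $q\ge r\ge 0$ there is a unique integer $p>r$ such that either (i) $r<p<q$ and $[p,p,r]$ is a $P$-position, or (ii) $p\ge q$ and $[p,q,r]$ is a $P$-position. This integer is denoted $f(q,r)$. OEIS sequences. A029900 and A029901 denote the two three-row Chomp opening-move sequences: the board sizes $n$ for which $[n,n,n]$ has a winning opening move in the second row, respectively in the third row. *)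

theory Defs
  imports Main
begin

text \<open>Row lengths \<open>(p, q, r)\<close> of a board. Only triples with \<open>p \<ge> q \<ge> r\<close> are positions; moves
  preserve this (lemma \<open>move_preserves_board\<close>), so the values of the predicates below on other
  triples never matter.\<close>
type_synonym position = "nat \<times> nat \<times> nat"

datatype row = First | Second | Third

inductive move :: "row \<Rightarrow> position \<Rightarrow> position \<Rightarrow> bool" where
  "a < p \<Longrightarrow> move First (p, q, r) (a, min a q, min a r)"
| "a < q \<Longrightarrow> move Second (p, q, r) (p, a, min a r)"
| "b < r \<Longrightarrow> move Third (p, q, r) (p, q, b)"

lemma move_preserves_board:
  assumes "move i (p, q, r) (p', q', r')" and "q \<le> p" and "r \<le> q"
  shows "q' \<le> p' \<and> r' \<le> q'"
  using assms by (auto elim!: move.cases)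

text \<open>The player to move wins at \<open>(0, 0, 0)\<close>, because moving there loses.\<close>
inductive N_position :: "position \<Rightarrow> bool" and P_position :: "position \<Rightarrow> bool" where
  N_end: "N_position (0, 0, 0)"
| N_step: "move i x y \<Longrightarrow> P_position y \<Longrightarrow> N_position x"
| P_step: "x \<noteq> (0, 0, 0) \<Longrightarrow> (\<forall>i y. move i x y \<longrightarrow> N_position y) \<Longrightarrow> P_position x"

lemma move_decreases:
  assumes "move i x y"
  shows "(case y of (p, q, r) \<Rightarrow> p + q + r) < (case x of (p, q, r) \<Rightarrow> p + q + r)"
  using assms by (cases) auto

lemma N_position_iff: "N_position x \<longleftrightarrow> \<not> P_position x"
proof (induction x rule: measure_induct_rule[where f = "\<lambda>(p, q, r). p + q + r"])
  case (less x)
  have IH: "N_position y \<longleftrightarrow> \<not> P_position y" if "move i x y" for i y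
    using less move_decreases[OF that] by blast
  have no_move: "\<not> move i (0, 0, 0) y" for i y
    using move_decreases[of i "(0, 0, 0)" y] by auto
  have N: "N_position x \<longleftrightarrow> x = (0, 0, 0) \<or> (\<exists>i y. move i x y \<and> P_position y)"
    by (subst N_position.simps) blast
  have P: "P_position x \<longleftrightarrow> x \<noteq> (0, 0, 0) \<and> (\<forall>i y. move i x y \<longrightarrow> N_position y)"
    by (subst P_position.simps) blast
  show ?case
    using IH no_move N P by blast
qed

lemma P_position_iff:
  "P_position x \<longleftrightarrow> x \<noteq> (0, 0, 0) \<and> (\<forall>i y. move i x y \<longrightarrow> \<not> P_position y)"
  using P_position.simps[of x] by (auto simp: N_position_iff)

definition winning_move :: "row \<Rightarrow> position \<Rightarrow> position \<Rightarrow> bool" where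
  "winning_move i x y \<longleftrightarrow> move i x y \<and> P_position y"

text \<open>Meaningful for \<open>r \<le> q\<close>.\<close>
definition f :: "nat \<Rightarrow> nat \<Rightarrow> nat" where
  "f q r = (THE p. (r < p \<and> p < q \<and> P_position (p, p, r)) \<or>
                   (r < p \<and> q \<le> p \<and> P_position (p, q, r)))"

definition D :: "nat set" where
  "D = {f a a |a. True}"

definition S :: "nat set" where
  "S = {p. p \<ge> 1 \<and> (\<exists>r<p. f p r = p)}"

definition A029900 :: "nat set" where
  "A029900 = {n. n \<ge> 1 \<and> (\<exists>y. winning_move Second (n, n, n) y)}"

definition A029901 :: "nat set" where
  "A029901 = {n. n \<ge> 1 \<and> (\<exists>y. winning_move Third (n, n, n) y)}"

end

theory Submission
  imports Defs "HOL-Library.Code_Binary_Nat"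
begin

text \<open>By strategy stealing \<open>(n, n, n)\<close> is never a P-position, so for every \<open>n \<ge> 1\<close> some \<open>(n, a, a)\<close> or some
  \<open>(n, n, r)\<close> with smaller \<open>a\<close>, \<open>r\<close> is one. To exclude both at once when \<open>r < a\<close>, one shows that a P-position
  \<open>(n, n, r)\<close> forces a P-position \<open>(n, y, c)\<close> with \<open>c < r\<close> for every \<open>y\<close> strictly between \<open>r\<close> and \<open>n\<close>, by
  downward induction on \<open>y\<close>. Every \<open>x\<close> with \<open>y < x \<le> n\<close> has a P-position \<open>(n, x, c)\<close> with \<open>c \<le> r\<close>, and these
  \<open>n - y\<close> values \<open>c\<close> are distinct. If no \<open>(n, y, c)\<close> with \<open>c < r\<close> were a P-position, each \<open>(n, y, c)\<close> could only
  be won by moving to some P-position \<open>(m, y, c)\<close> with \<open>y < m < n\<close>; the values \<open>m\<close> must be distinct, but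
  there are only \<open>n - y - 1\<close> of them.\<close>

section \<open>P-positions\<close>

lemma P_position_no_move:
  assumes "P_position (p, q, r)"
  shows P_position_no_First: "a < p \<Longrightarrow> \<not> P_position (a, min a q, min a r)"
    and P_position_no_Second: "b < q \<Longrightarrow> \<not> P_position (p, b, min b r)"
    and P_position_no_Third: "c < r \<Longrightarrow> \<not> P_position (p, q, c)"
proof -
  have no_move: "\<not> P_position y" if "move i (p, q, r) y" for i y
    using assms that P_position_iff by blast
  show "a < p \<Longrightarrow> \<not> P_position (a, min a q, min a r)"
    by (rule no_move[OF move.intros(1)])
  show "b < q \<Longrightarrow> \<not> P_position (p, b, min b r)"
    by (rule no_move[OF move.intros(2)])
  show "c < r \<Longrightarrow> \<not> P_position (p, q, c)"
    by (rule no_move[OF move.intros(3)])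
qed

lemma not_P_position_cases [consumes 2, case_names First Second Third]:
  assumes "\<not> P_position (p, q, r)" and "(p, q, r) \<noteq> (0, 0, 0)"
  obtains a where "a < p" "P_position (a, min a q, min a r)"
  | a where "a < q" "P_position (p, a, min a r)"
  | b where "b < r" "P_position (p, q, b)"
proof -
  obtain i y where "move i (p, q, r) y" "P_position y"
    using assms P_position_iff by blast
  then show thesis
    using that by (auto elim: move.cases)
qed

lemma P_position_first_unique:
  assumes "P_position (p, min p q, min p r)" "P_position (p', min p' q, min p' r)"
  shows "p = p'"
proof -
  have "\<not> P_position (a, min a q, min a r)" if "a < b" "P_position (b, min b q, min b r)" for a b
    using P_position_no_First[OF that(2,1)] that(1) by (simp add: min.assoc[symmetric] min_absorb1)
  then show ?thesis
    using assms by (metis linorder_neqE_nat)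
qed

lemma P_position_second_unique:
  assumes "P_position (p, q, min q r)" "P_position (p, q', min q' r)"
  shows "q = q'"
proof -
  have "\<not> P_position (p, a, min a r)" if "a < b" "P_position (p, b, min b r)" for a b
    using P_position_no_Second[OF that(2,1)] that(1) by (simp add: min.assoc[symmetric] min_absorb1)
  then show ?thesis
    using assms by (metis linorder_neqE_nat)
qed

lemma P_position_third_unique:
  assumes "P_position (p, q, r)" "P_position (p, q, r')"
  shows "r = r'"
  using assms P_position_no_Third by (metis linorder_neqE_nat)

text \<open>Strategy stealing: every reply to \<open>(n, n, n - 1)\<close> is also a move from \<open>(n, n, n)\<close>.\<close>
lemma not_P_position_rectangle: "\<not> P_position (n, n, n)"
proof
  assume P: "P_position (n, n, n)"
  then have no_move: "\<not> P_position (a, a, a)" "\<not> P_position (n, a, a)" "\<not> P_position (n, n, a)" if "a < n" for a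
    using that P_position_no_move[OF P, of a] by simp_all
  have "n > 0"
    using P P_position_iff by (metis gr0I)
  then have "\<not> P_position (n, n, n - 1)" "(n, n, n - 1) \<noteq> (0, 0, 0)"
    using no_move(3) by simp_all
  then show False
    by (cases rule: not_P_position_cases) (use no_move in \<open>auto simp: min_def split: if_splits\<close>)
qed

lemma P_position_third_less_first:
  assumes "P_position (p, q, r)" "r \<le> q" "q \<le> p"
  shows "r < p"
  using assms not_P_position_rectangle[of p] by (metis le_antisym le_trans not_le_imp_less)

lemma finite_P_position_first: "finite {p. P_position (p, q, r)}"
proof (cases "\<exists>p\<ge>max q r. P_position (p, q, r)")
  case True
  then obtain p where p: "max q r \<le> p" "P_position (p, q, r)"
    by blast
  have "p' = p" if "P_position (p', q, r)" "max q r \<le> p'" for p'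
    using P_position_first_unique[of p' q r p] p that by simp
  then have "{p. P_position (p, q, r)} \<subseteq> insert p {..<max q r}"
    using not_le by blast
  then show ?thesis
    by (rule finite_subset) simp
next
  case False
  then have "{p. P_position (p, q, r)} \<subseteq> {..<max q r}"
    using not_le by blast
  then show ?thesis
    by (rule finite_subset) simp
qed

section \<open>Exclusion of two winning openings\<close>

text \<open>The moves from \<open>(n, y, c)\<close> that are not already moves from \<open>(n, x, c)\<close> are those in the third row and
  those shortening the first row to a length \<open>m > y\<close>.\<close>
lemma P_position_shorten_second_row:
  assumes P: "P_position (n, x, c)" and "c < y" "y < x"
    and third: "\<And>b. b < c \<Longrightarrow> \<not> P_position (n, y, b)"
  shows "\<exists>m. y < m \<and> m < n \<and> P_position (m, y, c)"
proof -
  have "\<not> P_position (n, y, c)" "(n, y, c) \<noteq> (0, 0, 0)"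
    using P_position_no_Second[OF P \<open>y < x\<close>] \<open>c < y\<close> by auto
  then show ?thesis
  proof (cases rule: not_P_position_cases)
    case (First a)
    then have "\<not> a \<le> y"
      using P_position_no_First[OF P, of a] \<open>y < x\<close> by auto
    then show ?thesis
      using First \<open>c < y\<close> by (intro exI[of _ a]) simp
  next
    case (Second a)
    then show ?thesis
      using P_position_no_Second[OF P, of a] \<open>y < x\<close> by simp
  next
    case (Third b)
    then show ?thesis
      using third by blast
  qed
qed

lemma P_position_lower_third_row_step:
  assumes top: "P_position (n, n, r)" and "r < y" "y < n"
    and above: "\<And>x. y < x \<Longrightarrow> x < n \<Longrightarrow> \<exists>c<r. P_position (n, x, c)"
  shows "\<exists>c<r. P_position (n, y, c)"
proof (rule ccontr)
  assume "\<not> ?thesis"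
  then have free: "\<not> P_position (n, y, c)" if "c < r" for c
    using that by blast
  have "\<exists>c\<le>r. P_position (n, x, c)" if "x \<in> {y<..n}" for x
    using that top above[of x] less_imp_le by (cases "x = n") auto
  then obtain third where third: "\<And>x. x \<in> {y<..n} \<Longrightarrow> third x \<le> r \<and> P_position (n, x, third x)"
    by metis
  have "\<exists>m. y < m \<and> m < n \<and> P_position (m, y, third x)" if "x \<in> {y<..n}" for x
    by (rule P_position_shorten_second_row[of n x]) (use third[OF that] that \<open>r < y\<close> free in auto)
  then obtain first where
    first: "\<And>x. x \<in> {y<..n} \<Longrightarrow> first x \<in> {y<..<n} \<and> P_position (first x, y, third x)"
    unfolding greaterThanLessThan_iff by metis
  have "inj_on first {y<..n}"
  proof (rule inj_onI)
    fix x x' assume x: "x \<in> {y<..n}" "x' \<in> {y<..n}" and "first x = first x'"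
    then have "third x = third x'"
      using first[OF x(1)] first[OF x(2)] P_position_third_unique[of "first x" y] by simp
    then show "x = x'"
      using P_position_second_unique[of n x "third x" x'] third[OF x(1)] third[OF x(2)] x \<open>r < y\<close> by simp
  qed
  then have "card {y<..n} \<le> card {y<..<n}"
    using first by (intro card_inj_on_le[of first]) auto
  then show False
    using \<open>y < n\<close> by simp
qed

lemma P_position_lower_third_row:
  assumes "P_position (n, n, r)" "r < y" "y < n"
  shows "\<exists>c<r. P_position (n, y, c)"
  using assms(2,3)
proof (induction "n - y" arbitrary: y rule: less_induct)
  case less
  show ?case
  proof (rule P_position_lower_third_row_step[OF assms(1) less.prems])
    show "\<exists>c<r. P_position (n, x, c)" if "y < x" "x < n" for x
      using that less.prems by (intro less.hyps) simp_all
  qed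
qed

lemma second_third_openings_exclusive:
  assumes "P_position (n, a, a)" "P_position (n, n, r)" "a < n" "r \<le> n"
  shows False
proof (cases "a \<le> r")
  case True
  then show False
    using P_position_second_unique[of n a r n] assms by simp
next
  case False
  then obtain c where "c < r" "P_position (n, a, c)"
    using P_position_lower_third_row[of n r a] assms by auto
  then show False
    using P_position_third_unique[of n a c a] assms False by simp
qed

section \<open>The function \<open>f\<close>\<close>

text \<open>If there were no such \<open>p\<close>, each \<open>(p, q, r)\<close> with \<open>p > q\<close> would have a winning move in the second or
  third row, so one of finitely many pairs of lower rows would occur in P-positions with infinitely many
  first rows.\<close>
lemma ex_P_position_first:
  assumes "r \<le> q"
  shows "\<exists>p>r. P_position (p, min p q, r)"
proof (rule ccontr)
  assume none: "\<not> ?thesis"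
  have lower: "\<exists>b\<le>q. \<exists>c\<le>r. P_position (p, b, c)" if "q < p" for p
  proof -
    have "\<not> P_position (p, q, r)" "(p, q, r) \<noteq> (0, 0, 0)"
      using none that assms by (auto dest: spec[of _ p])
    then show ?thesis
    proof (cases rule: not_P_position_cases)
      case (First a)
      then have "a \<le> r"
        using none by (metis min.absorb2 not_le_imp_less less_imp_le)
      then show ?thesis
        using First assms not_P_position_rectangle[of a] by simp
    next
      case (Second a)
      then show ?thesis
        by (meson less_imp_le min.cobounded2)
    next
      case (Third b)
      then show ?thesis
        by (meson less_imp_le order_refl)
    qed
  qed
  have "finite (\<Union>b\<le>q. \<Union>c\<le>r. {p. P_position (p, b, c)})"
    by (simp add: finite_P_position_first)
  moreover have "{q<..} \<subseteq> (\<Union>b\<le>q. \<Union>c\<le>r. {p. P_position (p, b, c)})"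
    using lower by fastforce
  ultimately show False
    using infinite_Ioi finite_subset by blast
qed

lemma f_eq_iff:
  assumes "r \<le> q"
  shows "f q r = p \<longleftrightarrow> r < p \<and> P_position (p, min p q, r)"
proof -
  have unique: "p = p'"
    if "r < p" "P_position (p, min p q, r)" "r < p'" "P_position (p', min p' q, r)" for p p'
    using P_position_first_unique[of p q r p'] that by simp
  have "f q r = (THE p. r < p \<and> P_position (p, min p q, r))"
    unfolding f_def by (rule arg_cong[where f = The]) (auto simp: fun_eq_iff min_def order_le_less)
  moreover obtain p' where p': "r < p'" "P_position (p', min p' q, r)"
    using ex_P_position_first[OF assms] by blast
  ultimately have "f q r = p'"
    using unique by (metis (no_types, lifting) the_equality)
  then show ?thesis
    using p' unique by blast
qed

lemma less_f: "r \<le> q \<Longrightarrow> r < f q r"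
  using f_eq_iff[of r q "f q r"] by simp

lemma P_position_iff_f:
  assumes "r \<le> q" "q \<le> p"
  shows "P_position (p, q, r) \<longleftrightarrow> f q r = p"
  using assms f_eq_iff[of r q p] P_position_third_less_first by auto

lemma f_eq_cong:
  assumes "r \<le> q" "r \<le> q'" "p \<le> q" "p \<le> q'"
  shows "f q r = p \<longleftrightarrow> f q' r = p"
  using assms by (simp add: f_eq_iff)

lemma inj_f_diagonal: "inj (\<lambda>a. f a a)"
proof (rule injI)
  fix a b assume eq: "f a a = f b b"
  have "P_position (f a a, a, a)" "P_position (f a a, b, b)"
    using less_f[of a a] less_f[of b b] eq by (simp_all add: P_position_iff_f)
  then show "a = b"
    using P_position_second_unique[of "f a a" a "max a b" b] by simp
qed

lemma f_fixed_point_unique: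
  assumes "f n r = n" "f n r' = n" "r \<le> n" "r' \<le> n"
  shows "r = r'"
  using assms P_position_third_unique by (metis P_position_iff_f order_refl)

section \<open>Opening moves\<close>

lemma not_winning_First: "\<not> winning_move First (n, n, n) y"
  by (auto simp: winning_move_def not_P_position_rectangle elim: move.cases)

lemma winning_Second_iff: "winning_move Second (n, n, n) y \<longleftrightarrow> (\<exists>a. y = (n, a, a) \<and> n = f a a)"
proof -
  have "move Second (n, n, n) y \<longleftrightarrow> (\<exists>a<n. y = (n, a, a))"
    by (subst move.simps) auto
  then show ?thesis
    using P_position_iff_f[OF order_refl, of _ n] less_f[OF order_refl]
    by (auto simp: winning_move_def less_imp_le)
qed

lemma winning_Third_iff: "winning_move Third (n, n, n) y \<longleftrightarrow> (\<exists>r<n. y = (n, n, r) \<and> f n r = n)"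
proof -
  have "move Third (n, n, n) y \<longleftrightarrow> (\<exists>r<n. y = (n, n, r))"
    by (subst move.simps) auto
  then show ?thesis
    by (auto simp: winning_move_def P_position_iff_f)
qed

lemma ex_winning_Second_iff: "(\<exists>y. winning_move Second (n, n, n) y) \<longleftrightarrow> n \<in> D"
  by (auto simp: winning_Second_iff D_def)

lemma ex_winning_Third_iff: "(\<exists>y. winning_move Third (n, n, n) y) \<longleftrightarrow> n \<in> S"
  by (auto simp: winning_Third_iff S_def)

lemma winning_Second_move:
  assumes "n \<in> D"
  shows "\<exists>a<n. (\<forall>a'. n = f a' a' \<longleftrightarrow> a' = a) \<and> (\<forall>y. winning_move Second (n, n, n) y \<longleftrightarrow> y = (n, a, a))"
proof -
  obtain a where n: "n = f a a"
    using assms by (auto simp: D_def)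
  have "n = f a' a' \<longleftrightarrow> a' = a" for a'
    using inj_eq[OF inj_f_diagonal, of a a'] n by auto
  moreover have "a < n"
    using n less_f by simp
  ultimately show ?thesis
    by (auto simp: winning_Second_iff)
qed

lemma winning_Third_move:
  assumes "n \<in> S"
  shows "\<exists>r<n. (\<forall>r'\<le>n. f n r' = n \<longleftrightarrow> r' = r) \<and> (\<forall>y. winning_move Third (n, n, n) y \<longleftrightarrow> y = (n, n, r))"
proof -
  obtain r where r: "r < n" "f n r = n"
    using assms by (auto simp: S_def)
  then have "f n r' = n \<longleftrightarrow> r' = r" if "r' \<le> n" for r'
    using f_fixed_point_unique that by (metis less_imp_le)
  then show ?thesis
    using r by (intro exI[of _ r]) (auto simp: winning_Third_iff)
qed

lemma D_Int_S: "D \<inter> S = {}"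
proof -
  have False if "n = f a a" "r < n" "f n r = n" for n a r
  proof (rule second_third_openings_exclusive)
    show "a < n"
      using less_f[of a a] that(1) by simp
    then show "P_position (n, a, a)"
      using that(1) by (simp add: P_position_iff_f)
    show "P_position (n, n, r)"
      using that(2,3) by (simp add: P_position_iff_f)
  qed (use that(2) in simp)
  then show ?thesis
    by (auto simp: D_def S_def)
qed

lemma D_Un_S: "D \<union> S = {1..}"
proof
  have "1 \<le> f a a" for a
    using less_f[of a a] by simp
  then show "D \<union> S \<subseteq> {1..}"
    by (auto simp: D_def S_def)
  show "{1..} \<subseteq> D \<union> S"
  proof
    fix n :: nat assume "n \<in> {1..}"
    then obtain i y where "winning_move i (n, n, n) y"
      using not_P_position_rectangle[of n] P_position_iff[of "(n, n, n)"] by (force simp: winning_move_def)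
    then show "n \<in> D \<union> S"
      using not_winning_First ex_winning_Second_iff ex_winning_Third_iff by (metis UnCI row.exhaust)
  qed
qed

lemma ex1_winning_move:
  assumes "n \<ge> 1"
  shows "\<exists>!m. winning_move (fst m) (n, n, n) (snd m)"
proof -
  consider "n \<in> D" "n \<notin> S" | "n \<in> S" "n \<notin> D"
    using assms D_Int_S D_Un_S by (metis IntI UnE atLeast_iff empty_iff)
  then have "\<exists>m. \<forall>i y. winning_move i (n, n, n) y \<longleftrightarrow> (i, y) = m"
  proof cases
    case 1
    then obtain a where "\<And>y. winning_move Second (n, n, n) y \<longleftrightarrow> y = (n, a, a)"
      using winning_Second_move by blast
    moreover have "\<not> winning_move Third (n, n, n) y" for y
      using ex_winning_Third_iff \<open>n \<notin> S\<close> by blast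
    ultimately have "winning_move i (n, n, n) y \<longleftrightarrow> (i, y) = (Second, (n, a, a))" for i y
      using not_winning_First by (cases i) auto
    then show ?thesis
      by blast
  next
    case 2
    then obtain r where "\<And>y. winning_move Third (n, n, n) y \<longleftrightarrow> y = (n, n, r)"
      using winning_Third_move by blast
    moreover have "\<not> winning_move Second (n, n, n) y" for y
      using ex_winning_Second_iff \<open>n \<notin> D\<close> by blast
    ultimately have "winning_move i (n, n, n) y \<longleftrightarrow> (i, y) = (Third, (n, n, r))" for i y
      using not_winning_First by (cases i) auto
    then show ?thesis
      by blast
  qed
  then show ?thesis
    by auto
qed

lemma D_eq_A029900: "D = A029900"
  unfolding A029900_def ex_winning_Second_iff using D_Un_S by auto

lemma S_eq_A029901: "S = A029901"
  unfolding A029901_def ex_winning_Third_iff using D_Un_S by auto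

section \<open>Computing \<open>f\<close>\<close>

definition mex_from :: "nat \<Rightarrow> nat set \<Rightarrow> nat" where
  "mex_from q A = (LEAST p. q \<le> p \<and> p \<notin> A)"

lemma mex_from_code [code]: "mex_from q A = (if q \<in> A then mex_from (Suc q) A else q)"
proof (cases "q \<in> A")
  case True
  then have "q \<le> p \<and> p \<notin> A \<longleftrightarrow> Suc q \<le> p \<and> p \<notin> A" for p
    by (metis Suc_leD Suc_leI le_neq_implies_less)
  then show ?thesis
    using True by (simp add: mex_from_def)
qed (auto simp: mex_from_def intro: Least_equality)

definition excluded :: "nat \<Rightarrow> nat \<Rightarrow> nat set" where
  "excluded q r = (\<lambda>b. f b (min b r)) ` {..<q} \<union> f q ` {..<r}"

lemma excluded_eq:
  assumes "r \<le> q"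
  shows "excluded q r = (\<lambda>b. f b b) ` {..<r} \<union> (\<lambda>b. f b r) ` {r..<q} \<union> f q ` {..<r}"
proof -
  have "{..<q} = {..<r} \<union> {r..<q}"
    using assms by auto
  moreover have "(\<lambda>b. f b (min b r)) ` {..<r} = (\<lambda>b. f b b) ` {..<r}"
    by (rule image_cong) simp_all
  moreover have "(\<lambda>b. f b (min b r)) ` {r..<q} = (\<lambda>b. f b r) ` {r..<q}"
    by (rule image_cong) simp_all
  ultimately show ?thesis
    by (simp only: excluded_def image_Un)
qed

lemma f_notin_excluded:
  assumes "r \<le> q" "q \<le> f q r"
  shows "f q r \<notin> excluded q r"
proof -
  have P: "P_position (f q r, q, r)"
    using assms by (simp add: P_position_iff_f)
  have "f q r \<noteq> f b (min b r)" if "b < q" for b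
    using P_position_no_Second[OF P that] that assms(2) P_position_iff_f[of "min b r" b "f q r"] by simp
  moreover have "f q r \<noteq> f q b" if "b < r" for b
    using P_position_no_Third[OF P that] that assms P_position_iff_f[of b q "f q r"] by simp
  ultimately show ?thesis
    by (auto simp: excluded_def)
qed

lemma less_f_imp_in_excluded:
  assumes "r \<le> q" "q \<le> p" "r < p" "p < f q r"
  shows "p \<in> excluded q r"
proof -
  have P: "P_position (f q r, q, r)"
    using assms by (simp add: P_position_iff_f)
  have "\<not> P_position (p, q, r)" "(p, q, r) \<noteq> (0, 0, 0)"
    using assms by (auto simp: P_position_iff_f)
  then show ?thesis
  proof (cases rule: not_P_position_cases)
    case (First a)
    then show ?thesis
      using P_position_no_First[OF P, of a] \<open>p < f q r\<close> by simp
  next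
    case (Second a)
    then show ?thesis
      using assms(2) P_position_iff_f[of "min a r" a p] by (auto simp: excluded_def)
  next
    case (Third b)
    then show ?thesis
      using assms(1,2) P_position_iff_f[of b q p] by (auto simp: excluded_def)
  qed
qed

lemma f_eq_mex_from:
  assumes "r \<le> q" "q \<le> f q r"
  shows "f q r = mex_from (max q (Suc r)) (excluded q r)"
  unfolding mex_from_def
proof (rule Least_equality[symmetric])
  show "max q (Suc r) \<le> f q r \<and> f q r \<notin> excluded q r"
    using assms f_notin_excluded less_f[of r q] by simp
  show "f q r \<le> p" if "max q (Suc r) \<le> p \<and> p \<notin> excluded q r" for p
    using that less_f_imp_in_excluded[of r q p] assms(1) by (meson Suc_le_eq max.bounded_iff not_le)
qed

definition history :: "nat \<Rightarrow> nat \<Rightarrow> nat list" where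
  "history q r = map (\<lambda>b. f b r) (rev [r..<q])"

lemma history_self [simp]: "history q q = []"
  by (simp add: history_def)

lemma history_Suc: "r \<le> q \<Longrightarrow> history (Suc q) r = f q r # history q r"
  by (simp add: history_def)

lemma last_history: "r < q \<Longrightarrow> last (history q r) = f r r"
  by (simp add: history_def last_map last_rev)

text \<open>A history starting below \<open>q\<close> belongs to the first alternative in the definition of \<open>f\<close> and is constant
  from then on.\<close>
fun next_value :: "nat \<Rightarrow> nat list \<Rightarrow> nat list \<Rightarrow> nat" where
  "next_value q used [] = mex_from (Suc q) (set used)"
| "next_value q used (x # h) = (if x < q then x else mex_from q (set (used @ x # h)))"

lemma next_value_history:
  assumes "r \<le> q" and used: "set used = (\<lambda>b. f b b) ` {..<r} \<union> f q ` {..<r}"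
  shows "next_value q used (history q r) = f q r"
proof (cases "r = q")
  case True
  then show ?thesis
    using f_eq_mex_from[of q q] less_f[of q q] used by (simp add: excluded_eq)
next
  case False
  then have "r < q" "r \<le> q - 1" "q = Suc (q - 1)"
    using assms(1) by simp_all
  then have history: "history q r = f (q - 1) r # history (q - 1) r"
    using history_Suc by metis
  show ?thesis
  proof (cases "f (q - 1) r < q")
    case True
    then show ?thesis
      using f_eq_cong[of r "q - 1" q "f (q - 1) r"] \<open>r < q\<close> by (simp add: history)
  next
    case False
    have "f (q - 1) r = f q r" if "f q r < q"
      using f_eq_cong[of r q "q - 1" "f q r"] \<open>r < q\<close> that by simp
    then have "q \<le> f q r"
      using False by linarith
    moreover have "set (used @ history q r) = excluded q r"
      using used assms(1) by (auto simp: history_def excluded_eq)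
    ultimately have "f q r = mex_from q (set (used @ history q r))"
      using f_eq_mex_from[of r q] \<open>r < q\<close> by (simp only: less_imp_le max_absorb1 Suc_leI)
    then show ?thesis
      using False by (simp add: history)
  qed
qed

fun extend_histories :: "nat \<Rightarrow> nat list \<Rightarrow> nat list list \<Rightarrow> nat list list" where
  "extend_histories q used [] = []"
| "extend_histories q used (h # hs) =
    (let h' = next_value q used h # h in h' # extend_histories q (hd h' # last h' # used) hs)"

lemma extend_histories_correct:
  assumes "r \<le> Suc q" "set used = (\<lambda>b. f b b) ` {..<r} \<union> f q ` {..<r}"
  shows "extend_histories q used (map (history q) [r..<Suc q]) = map (history (Suc q)) [r..<Suc q]"
  using assms
proof (induction r arbitrary: used rule: inc_induct)
  case (step r)
  have "next_value q used (history q r) # history q r = history (Suc q) r"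
    using step next_value_history[of r q used] by (simp add: history_Suc)
  moreover have "hd (history (Suc q) r) = f q r"
    using step.hyps by (simp add: history_Suc)
  moreover have "last (history (Suc q) r) = f r r"
    using step.hyps by (intro last_history)
  moreover have "extend_histories q (f q r # f r r # used) (map (history q) [Suc r..<Suc q]) =
      map (history (Suc q)) [Suc r..<Suc q]"
    using step.prems by (intro step.IH) (auto simp: lessThan_Suc)
  ultimately show ?case
    using step.hyps by (simp add: upt_conv_Cons del: upt_Suc)
qed simp

primrec histories :: "nat \<Rightarrow> nat list list" where
  "histories 0 = []"
| "histories (Suc q) = extend_histories q [] (histories q @ [[]])"

lemma histories_eq: "histories q = map (history q) [0..<q]"
proof (induction q)
  case (Suc q)
  have "histories q @ [[]] = map (history q) [0..<Suc q]"
    by (simp add: Suc)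
  then show ?case
    using extend_histories_correct[of 0 q "[]"] by (simp del: upt_Suc)
qed simp

section \<open>Initial terms\<close>

lemma S_atMost_eq: "{n \<in> S. n \<le> N} = {n \<in> f N ` {..N}. n \<le> N}"
proof -
  have "n \<in> S \<longleftrightarrow> n \<in> f N ` {..N}" if "n \<le> N" for n
  proof -
    have "f n r = n \<longleftrightarrow> f N r = n" if "r < n" for r
      using f_eq_cong[of r n N n] that \<open>n \<le> N\<close> by simp
    moreover have "r < n \<longleftrightarrow> r \<le> N" if "f N r = n" for r
      using less_f[of r N] \<open>n \<le> N\<close> that by auto
    ultimately have "(\<exists>r<n. f n r = n) \<longleftrightarrow> (\<exists>r\<le>N. f N r = n)"
      by blast
    then show ?thesis
      by (auto simp: S_def image_iff eq_commute[of n])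
  qed
  then show ?thesis
    by auto
qed

lemma S_atMost_code: "{n \<in> S. n \<le> N} = set (filter (\<lambda>n. n \<le> N) (map hd (histories (Suc N))))"
proof -
  have "set (map hd (histories (Suc N))) = (\<lambda>r. hd (history (Suc N) r)) ` {..N}"
    unfolding histories_eq set_map image_image set_upt atLeast0LessThan lessThan_Suc_atMost ..
  also have "\<dots> = f N ` {..N}"
    by (simp add: history_Suc)
  finally show ?thesis
    unfolding S_atMost_eq set_filter by simp
qed

lemma S_atMost_38: "{n \<in> S. n \<le> 38} = {2, 5, 7, 9, 12, 14, 17, 19, 22, 23, 26, 29, 31, 33, 36, 38}"
proof -
  have "filter (\<lambda>n. n \<le> 38) (map hd (histories (Suc 38))) =
      [2, 5, 7, 9, 12, 14, 17, 19, 22, 23, 26, 29, 31, 33, 36, 38]"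
    by code_simp
  then show ?thesis
    unfolding S_atMost_code by simp
qed

lemma D_atMost_27: "{n \<in> D. n \<le> 27} = {1, 3, 4, 6, 8, 10, 11, 13, 15, 16, 18, 20, 21, 24, 25, 27}"
proof -
  have "{n \<in> D. n \<le> 27} = {1..27} - {n \<in> S. n \<le> 38}"
    using D_Int_S D_Un_S by fastforce
  also have "\<dots> = {1, 3, 4, 6, 8, 10, 11, 13, 15, 16, 18, 20, 21, 24, 25, 27}"
    unfolding S_atMost_38 by code_simp
  finally show ?thesis .
qed

theorem corollary4p5:
  shows "(\<forall>n\<ge>1.
            (\<exists>!m. winning_move (fst m) (n, n, n) (snd m)) \<and>
            \<not> (\<exists>y. winning_move First (n, n, n) y) \<and>
            ((\<exists>y. winning_move Second (n, n, n) y) \<longleftrightarrow> n \<in> D) \<and>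
            (n \<in> D \<longrightarrow>
              (\<exists>a<n. (\<forall>a'. n = f a' a' \<longleftrightarrow> a' = a) \<and>
                     (\<forall>y. winning_move Second (n, n, n) y \<longleftrightarrow> y = (n, a, a)))) \<and>
            ((\<exists>y. winning_move Third (n, n, n) y) \<longleftrightarrow> n \<in> S) \<and>
            (n \<in> S \<longrightarrow>
              (\<exists>r<n. (\<forall>r'\<le>n. f n r' = n \<longleftrightarrow> r' = r) \<and>
                     (\<forall>y. winning_move Third (n, n, n) y \<longleftrightarrow> y = (n, n, r))))) \<and>
         D = A029900 \<and> S = A029901 \<and>
         sorted_list_of_set {n \<in> A029900. n \<le> 27} =
           [1, 3, 4, 6, 8, 10, 11, 13, 15, 16, 18, 20, 21, 24, 25, 27] \<and>
         sorted_list_of_set {n \<in> A029901. n \<le> 38} =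
           [2, 5, 7, 9, 12, 14, 17, 19, 22, 23, 26, 29, 31, 33, 36, 38]"
proof (intro conjI allI impI)
  fix n :: nat
  assume "n \<ge> 1"
  then show "\<exists>!m. winning_move (fst m) (n, n, n) (snd m)"
    by (rule ex1_winning_move)
  show "\<not> (\<exists>y. winning_move First (n, n, n) y)"
    by (simp add: not_winning_First)
  show "(\<exists>y. winning_move Second (n, n, n) y) \<longleftrightarrow> n \<in> D"
    by (rule ex_winning_Second_iff)
  show "(\<exists>y. winning_move Third (n, n, n) y) \<longleftrightarrow> n \<in> S"
    by (rule ex_winning_Third_iff)
next
  show "sorted_list_of_set {n \<in> A029900. n \<le> 27} =
      [1, 3, 4, 6, 8, 10, 11, 13, 15, 16, 18, 20, 21, 24, 25, 27]"
    unfolding D_eq_A029900[symmetric] D_atMost_27 by simp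
  show "sorted_list_of_set {n \<in> A029901. n \<le> 38} =
      [2, 5, 7, 9, 12, 14, 17, 19, 22, 23, 26, 29, 31, 33, 36, 38]"
    unfolding S_eq_A029901[symmetric] S_atMost_38 by simp
qed (use winning_Second_move winning_Third_move D_eq_A029900 S_eq_A029901 in blast)+

end
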